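(* Let $d\ge2$ and suppose $A\subseteq\mathbb{Z}$ is $d$-automatic and not $d$-sparse. If $A$ is stable in $(\mathbb{Z},+)$, then $A$ is generic, i.e. some finite union of additive translates $c_1+A,\ldots,c_k+A$ covers $\mathbb{Z}$.
   Context: For a string $k_0\cdots k_n$ of integers, $[k_0\cdots k_n]=\sum_ik_id^i$. $\Sigma=\{0,\ldots,d-1\}$, $\Sigma_\pm=\{-d+1,\ldots,d-1\}$. $A\subseteq\mathbb{Z}$ is $d$-automatic if $\{\sigma\in\Sigma_\pm^*:[\sigma]\in A\}$ is regular. The canonical representation of $0$ is the empty word, of $a>0$ its usual base-$d$ digit string in $\Sigma^*$ written least significant digit first, and of $a<0$ the word $(-k_0)\cdots(-k_n)$ where $k_0\cdots k_n$ is that of $-a$. A language is sparse if it is regular and the number of its words of length $\le k$ is bounded by a polynomial in $k$; $A$ is $d$-sparse if its set of canonical representations is sparse. $A$ is stable in $(\mathbb{Z},+)$ if there is $N$ such that there are no $a_0,\ldots,a_N,b_0,\ldots,b_N\in\mathbb{Z}$ with $a_i+b_j\in A\iff i\le j$. *)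

theory Defs
  imports Complex_Main "HOL-Computational_Algebra.Polynomial"
begin

text \<open>
  Regularity over a finite alphabet \<open>S\<close> is recognisability by a complete deterministic finite
  automaton. Taking the states to be natural numbers loses nothing, since any finite state set
  can be renamed.
\<close>

definition regular_lang :: "'a set \<Rightarrow> 'a list set \<Rightarrow> bool" where
  "regular_lang S L \<longleftrightarrow> finite S \<and>
     (\<exists>(Q :: nat set) q0 \<delta> F.
        finite Q \<and> q0 \<in> Q \<and> F \<subseteq> Q \<and> (\<forall>q\<in>Q. \<forall>s\<in>S. \<delta> q s \<in> Q) \<and>
        L = {w \<in> lists S. foldl \<delta> q0 w \<in> F})"

definition sparse_lang :: "'a set \<Rightarrow> 'a list set \<Rightarrow> bool" where
  "sparse_lang S L \<longleftrightarrow> regular_lang S L \<and>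
     (\<exists>p :: real poly. \<forall>k :: nat. real (card {w \<in> L. length w \<le> k}) \<le> poly p (real k))"

definition word_value :: "int \<Rightarrow> int list \<Rightarrow> int" where
  "word_value d ks = (\<Sum>i<length ks. ks ! i * d ^ i)"

definition signed_digits :: "int \<Rightarrow> int set" where
  "signed_digits d = {- d + 1..d - 1}"

text \<open>
  Least significant digit first; the test \<open>d < 2\<close> only serves to make the function total.
\<close>

function base_digits :: "int \<Rightarrow> int \<Rightarrow> int list" where
  "base_digits d a =
     (if d < 2 \<or> a \<le> 0 then [] else (a mod d) # base_digits d (a div d))"
  by auto
termination
  by (relation "measure (\<lambda>(d, a). nat a)") (auto simp: int_div_less_self)

declare base_digits.simps [simp del]

definition canonical_rep :: "int \<Rightarrow> int \<Rightarrow> int list" where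
  "canonical_rep d a = (if a \<ge> 0 then base_digits d a else map uminus (base_digits d (- a)))"

definition automatic_set :: "int \<Rightarrow> int set \<Rightarrow> bool" where
  "automatic_set d A \<longleftrightarrow>
     regular_lang (signed_digits d) {w \<in> lists (signed_digits d). word_value d w \<in> A}"

definition sparse_set :: "int \<Rightarrow> int set \<Rightarrow> bool" where
  "sparse_set d A \<longleftrightarrow> sparse_lang (signed_digits d) (canonical_rep d ` A)"

definition stable_set :: "int set \<Rightarrow> bool" where
  "stable_set A \<longleftrightarrow>
     (\<exists>N :: nat. \<not> (\<exists>a b :: nat \<Rightarrow> int. \<forall>i\<le>N. \<forall>j\<le>N. a i + b j \<in> A \<longleftrightarrow> i \<le> j))"

definition generic_set :: "int set \<Rightarrow> bool" where
  "generic_set A \<longleftrightarrow> (\<exists>C :: int set. finite C \<and> (\<Union>c\<in>C. (\<lambda>x. c + x) ` A) = UNIV)"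

lemma word_value_Nil [simp]: "word_value d [] = 0"
  by (simp add: word_value_def)

lemma word_value_Cons [simp]: "word_value d (k # ks) = k + d * word_value d ks"
  by (simp add: word_value_def sum.lessThan_Suc_shift sum_distrib_left mult_ac
      del: sum.lessThan_Suc)

lemma word_value_map_uminus [simp]: "word_value d (map uminus ks) = - word_value d ks"
  by (induction ks) auto

lemma word_value_base_digits:
  assumes "d \<ge> 2" "a \<ge> 0"
  shows "word_value d (base_digits d a) = a"
  using assms
proof (induction d a rule: base_digits.induct)
  case (1 d a)
  then show ?case
    by (cases "a \<le> 0") (simp_all add: base_digits.simps[of d a] base_digits.simps[of d 0] pos_imp_zdiv_nonneg_iff)
qed

lemma base_digits_in_lists:
  assumes "d \<ge> 2"
  shows "base_digits d a \<in> lists {0..d - 1}"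
  using assms
proof (induction d a rule: base_digits.induct)
  case (1 d a)
  then show ?case
    by (cases "a \<le> 0") (simp_all add: base_digits.simps[of d a])
qed

lemma word_value_canonical_rep:
  "d \<ge> 2 \<Longrightarrow> word_value d (canonical_rep d a) = a"
  by (simp add: canonical_rep_def word_value_base_digits)

lemma canonical_rep_in_lists:
  assumes "d \<ge> 2"
  shows "canonical_rep d a \<in> lists (signed_digits d)"
  using base_digits_in_lists[OF assms, of a] base_digits_in_lists[OF assms, of "- a"]
  by (auto simp: canonical_rep_def signed_digits_def subset_iff in_lists_conv_set)

end

theory Submission
  imports Defs
begin

text \<open>
  A language that is not sparse passes through some state of its automaton carrying two distinct
  loops of equal length. Digit words over one sign have distinct values, so some residual
  \<open>E = {n. [u] + d^|u| n \<in> A}\<close>, again stable, satisfies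
  \<open>n \<in> E \<longleftrightarrow> r + D n \<in> E \<longleftrightarrow> s + D n \<in> E\<close> with \<open>r \<noteq> s\<close>, where \<open>D\<close> is a power of \<open>d\<close>.

  Stability forces \<open>E\<close> to contain arbitrarily long progressions of difference \<open>s - r\<close>:
  consider numbers with \<open>s\<close>-type blocks of base-\<open>D\<close> digits below position \<open>j\<close> and \<open>r\<close>-type
  blocks from there on, and add \<open>c - r\<close> at position \<open>i\<close>. This replaces the digit by
  \<open>c\<close> if \<open>i \<ge> j\<close> and by \<open>c + (s - r)\<close> if \<open>i < j\<close>; if the former always stayed in \<open>E\<close> and the
  latter always left it, \<open>E\<close> would order \<open>i\<close> and \<open>j\<close>. The kernel of \<open>E\<close> being finite, the higher
  digits matter only through a finite type, and the blocks can be chosen to return to the same type;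
  so membership for \<open>c\<close> passes to \<open>c + (s - r)\<close>, starting from \<open>c = r\<close>.

  If \<open>E\<close> were not generic, no finite union of its translates would contain all multiples of
  \<open>s - r\<close>, whereas every finite set of such multiples has a translate inside \<open>E\<close>. Alternating
  the two builds an infinite ladder, a contradiction.
\<close>

section \<open>Digit words, stability and genericity\<close>

lemma word_value_append:
  "word_value d (u @ v) = word_value d u + d ^ length u * word_value d v"
  by (induction u) (auto simp: algebra_simps)

lemma abs_word_value_le:
  assumes "\<forall>x\<in>set w. \<bar>x\<bar> < d" "d \<ge> 1"
  shows "\<bar>word_value d w\<bar> < d ^ length w"
  using assms(1)
proof (induction w)
  case (Cons x w)
  have "\<bar>x + d * word_value d w\<bar> \<le> \<bar>x\<bar> + d * \<bar>word_value d w\<bar>"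
    using assms(2) abs_triangle_ineq[of x "d * word_value d w"] by (simp add: abs_mult)
  also have "\<dots> \<le> (d - 1) + d * (d ^ length w - 1)"
    using Cons assms(2) by (intro add_mono mult_left_mono) auto
  also have "\<dots> < d ^ length (x # w)"
    by (simp add: algebra_simps)
  finally show ?case by simp
qed simp

text \<open>Writes the digits \<open>w\<close> below \<open>n\<close>. As a map on integers it
  leaves the higher part free of any chosen word, and changing one digit is adding a multiple of a
  power of \<open>d\<close>.\<close>

definition prepend :: "int \<Rightarrow> int list \<Rightarrow> int \<Rightarrow> int" where
  "prepend d w n = word_value d w + d ^ length w * n"

lemma prepend_Nil [simp]: "prepend d [] n = n"
  by (simp add: prepend_def)

lemma prepend_Cons: "prepend d (k # w) n = k + d * prepend d w n"
  by (simp add: prepend_def algebra_simps)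

lemma prepend_append: "prepend d (u @ v) n = prepend d u (prepend d v n)"
  by (simp add: prepend_def word_value_append power_add algebra_simps)

lemma prepend_add: "prepend d w n + d ^ length w * m = prepend d w (n + m)"
  by (simp add: prepend_def algebra_simps)

lemma stable_set_affine_preimage:
  assumes "stable_set A"
  shows "stable_set {n. c + e * n \<in> A}"
proof -
  obtain N where N: "\<And>a b :: nat \<Rightarrow> int. \<not> (\<forall>i\<le>N. \<forall>j\<le>N. a i + b j \<in> A \<longleftrightarrow> i \<le> j)"
    using assms unfolding stable_set_def by blast
  have "\<not> (\<forall>i\<le>N. \<forall>j\<le>N. a i + b j \<in> {n. c + e * n \<in> A} \<longleftrightarrow> i \<le> j)" for a b
    using N[of "\<lambda>i. c + e * a i" "\<lambda>j. e * b j"] by (simp add: algebra_simps)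
  then show ?thesis unfolding stable_set_def by blast
qed

lemma generic_setI:
  assumes "finite C" "\<And>x. \<exists>c\<in>C. x + c \<in> A"
  shows "generic_set A"
  unfolding generic_set_def
proof (intro exI conjI)
  show "finite (uminus ` C)" using assms(1) by simp
  show "(\<Union>c\<in>uminus ` C. (\<lambda>x. c + x) ` A) = UNIV"
  proof (intro equalityI subsetI UNIV_I)
    fix x :: int
    obtain c where "c \<in> C" "x + c \<in> A" using assms(2) by blast
    moreover have "x = - c + (x + c)" by simp
    ultimately show "x \<in> (\<Union>c\<in>uminus ` C. (\<lambda>x. c + x) ` A)" by blast
  qed
qed

lemma generic_setD:
  assumes "generic_set A"
  obtains C where "finite C" "\<And>x. \<exists>c\<in>C. x + c \<in> A"
proof -
  obtain C where C: "finite C" "(\<Union>c\<in>C. (\<lambda>x. c + x) ` A) = UNIV"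
    using assms unfolding generic_set_def by blast
  have "\<exists>c\<in>uminus ` C. x + c \<in> A" for x
  proof -
    have "x \<in> (\<Union>c\<in>C. (\<lambda>x. c + x) ` A)" using C(2) by simp
    then show ?thesis by force
  qed
  with C(1) show ?thesis by (intro that[of "uminus ` C"]) auto
qed

text \<open>Each integer is a multiple of \<open>e\<close> plus one of finitely many remainders, so
  correcting every shift by every possible remainder is enough.\<close>

lemma generic_set_of_multiples:
  assumes "finite C" "e \<noteq> 0" "\<And>n. \<exists>c\<in>C. e * n + c \<in> A"
  shows "generic_set A"
proof (rule generic_setI)
  show "finite ((\<lambda>(s, c). c - s) ` ({- \<bar>e\<bar>..\<bar>e\<bar>} \<times> C))" using assms(1) by simp
  fix x :: int
  obtain c where c: "c \<in> C" "e * (x div e) + c \<in> A" using assms(3) by blast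
  have "x mod e \<in> {- \<bar>e\<bar>..\<bar>e\<bar>}"
    using abs_mod_less[of e x] assms(2) by auto
  moreover have "x + (c - x mod e) \<in> A"
    using c(2) by (simp add: minus_mod_eq_mult_div algebra_simps)
      (metis add.commute add_diff_cancel_left' c(2) diff_add_eq mod_mult_div_eq)
  ultimately show "\<exists>c\<in>(\<lambda>(s, c). c - s) ` ({- \<bar>e\<bar>..\<bar>e\<bar>} \<times> C). x + c \<in> A"
    using c(1) by (intro bexI[of _ "c - x mod e"]) (auto intro!: image_eqI[of _ _ "(x mod e, c)"])
qed

lemma generic_set_affine_preimage:
  assumes "generic_set {n. c + e * n \<in> A}" "e \<noteq> 0"
  shows "generic_set A"
proof -
  obtain C where C: "finite C" "\<And>x. \<exists>y\<in>C. x + y \<in> {n. c + e * n \<in> A}"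
    using generic_setD[OF assms(1)] by blast
  show ?thesis
  proof (rule generic_set_of_multiples[OF _ assms(2)])
    show "finite ((\<lambda>y. c + e * y) ` C)" using C(1) by simp
    show "\<exists>c\<in>(\<lambda>y. c + e * y) ` C. e * n + c \<in> A" for n
      using C(2)[of n] by (auto simp: algebra_simps)
  qed
qed

text \<open>Without genericity every finite set of shifts is missed by some multiple of
  \<open>e\<close>; the progressions put every finite set of multiples inside \<open>A\<close> after
  one shift. Together they extend any finite ladder by a rung.\<close>

lemma generic_set_if_long_progressions:
  assumes "stable_set A" "e \<noteq> 0"
    and progs: "\<And>M :: nat. \<exists>x. \<forall>m\<le>M. x + int m * e \<in> A"
  shows "generic_set A"
proof (rule ccontr)
  assume ng: "\<not> generic_set A"
  \<comment> \<open>Starting at \<open>x + K * e\<close> recentres a progression of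
    \<open>2 * K\<close> steps, so negative multiples are reached too.\<close>
  have fin: "\<exists>x. \<forall>m\<in>S. x + m * e \<in> A" if "finite S" for S :: "int set"
  proof -
    have "finite (abs ` S)" using that by simp
    then obtain K where K: "\<And>m. m \<in> S \<Longrightarrow> \<bar>m\<bar> \<le> K"
      by (meson bdd_above_finite bdd_above.unfold imageI)
    obtain x where x: "\<forall>m\<le>nat (2 * K). x + int m * e \<in> A" using progs by blast
    have "x + K * e + m * e \<in> A" if "m \<in> S" for m
    proof -
      have "nat (K + m) \<le> nat (2 * K)" "0 \<le> K + m" using K[OF that] by auto
      with x have "x + (K + m) * e \<in> A" by (metis int_nat_eq)
      then show ?thesis by (simp add: algebra_simps)
    qed
    then show ?thesis by blast
  qed
  have ladder: "\<exists>a b :: nat \<Rightarrow> int. (\<forall>i<n. \<forall>j<n. a i * e + b j \<in> A \<longleftrightarrow> i \<le> j)" for n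
  proof (induction n)
    case (Suc n)
    then obtain a b :: "nat \<Rightarrow> int"
      where ab: "\<forall>i<n. \<forall>j<n. a i * e + b j \<in> A \<longleftrightarrow> i \<le> j" by blast
    \<comment> \<open>The new row \<open>g\<close> fails against all old columns; the new column
      \<open>h\<close> is then chosen to succeed against all rows, \<open>g\<close>
      included.\<close>
    have "\<exists>g. \<forall>c\<in>b ` {..<n}. e * g + c \<notin> A"
      using generic_set_of_multiples[of "b ` {..<n}" e A] assms(2) ng by blast
    then obtain g where g: "\<And>j. j < n \<Longrightarrow> g * e + b j \<notin> A" by (auto simp: mult.commute)
    obtain h where h: "\<forall>m\<in>insert g (a ` {..<n}). h + m * e \<in> A"
      using fin[of "insert g (a ` {..<n})"] by auto
    have "\<forall>i<Suc n. \<forall>j<Suc n. (a(n := g)) i * e + (b(n := h)) j \<in> A \<longleftrightarrow> i \<le> j"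
      using ab g h by (auto simp: less_Suc_eq add.commute)
    then show ?case by blast
  qed simp
  obtain N where N: "\<And>a b :: nat \<Rightarrow> int. \<not> (\<forall>i\<le>N. \<forall>j\<le>N. a i + b j \<in> A \<longleftrightarrow> i \<le> j)"
    using assms(1) unfolding stable_set_def by blast
  obtain a b :: "nat \<Rightarrow> int"
    where "\<forall>i<Suc N. \<forall>j<Suc N. a i * e + b j \<in> A \<longleftrightarrow> i \<le> j" using ladder by blast
  then show False using N[of "\<lambda>i. a i * e" b] by (auto simp: less_Suc_eq_le)
qed

section \<open>Sets invariant under two digit maps\<close>

text \<open>Abstracts a residual at a state with two loops of equal length: \<open>D\<close> is
  \<open>d\<close> to that length, \<open>r\<close> and \<open>s\<close> are the loop values. The
  kernel bound is needed for every \<open>B\<close>, since the offset \<open>c\<close> of a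
  lengthening progression outgrows a single digit.\<close>

locale branching_set =
  fixes D r s :: int and A :: "int set"
  assumes D_pos: "D \<ge> 1"
    and digit_less: "\<bar>r\<bar> < D" "\<bar>s\<bar> < D"
    and r_neq_s: "r \<noteq> s"
    and absorb_r: "r + D * n \<in> A \<longleftrightarrow> n \<in> A"
    and absorb_s: "s + D * n \<in> A \<longleftrightarrow> n \<in> A"
    and nonempty: "A \<noteq> {}"
    and finite_kernel: "finite {{n. c + D ^ k * n \<in> A} | k c. \<bar>c\<bar> \<le> B * D ^ k}"
    and stable: "stable_set A"
begin

abbreviation wds :: "int list set" where "wds \<equiv> lists {r, s}"

lemma prepend_mem_iff: "w \<in> wds \<Longrightarrow> prepend D w n \<in> A \<longleftrightarrow> n \<in> A"
  by (induction w) (auto simp: prepend_Cons absorb_r absorb_s)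

text \<open>All that a word of loop digits on top of the offset \<open>c\<close> can detect of the
  higher part \<open>z\<close>. Words are inserted between \<open>c\<close> and \<open>z\<close>, so
  this is a Nerode class of \<open>z\<close>.\<close>

definition tail_type :: "int \<Rightarrow> int \<Rightarrow> int list set" where
  "tail_type c z = {w \<in> wds. c + D * prepend D w z \<in> A}"

lemma tail_type_prepend:
  assumes "v \<in> wds"
  shows "tail_type c (prepend D v z) = {w \<in> wds. w @ v \<in> tail_type c z}"
  using assms by (auto simp: tail_type_def prepend_append)

text \<open>For each \<open>w\<close> the condition on \<open>z\<close> is membership in a kernel
  set \<open>K w\<close>. Finitely many such sets occur, and the type depends only on which of them
  contain \<open>z\<close>.\<close>

lemma finite_tail_types: "finite (range (tail_type c))"
proof -
  define K where "K w = {n. c + D * prepend D w n \<in> A}" for w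
  \<comment> \<open>The summand \<open>1\<close> in the bound pays for the digits of
    \<open>w\<close>, whose value is below \<open>D ^ length w\<close>.\<close>
  define fam where "fam = {{n. c' + D ^ k * n \<in> A} | k c'. \<bar>c'\<bar> \<le> (\<bar>c\<bar> + 1) * D ^ k}"
  have K_fam: "K w \<in> fam" if "w \<in> wds" for w
  proof -
    have K: "K w = {n. (c + D * word_value D w) + D ^ Suc (length w) * n \<in> A}"
      by (simp add: K_def prepend_def algebra_simps)
    have "\<bar>word_value D w\<bar> < D ^ length w"
      using that digit_less D_pos by (intro abs_word_value_le) auto
    then have "D * \<bar>word_value D w\<bar> \<le> D * D ^ length w"
      using D_pos by (intro mult_left_mono) auto
    moreover have "\<bar>c\<bar> * 1 \<le> \<bar>c\<bar> * D ^ Suc (length w)"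
      using D_pos by (intro mult_left_mono one_le_power) auto
    moreover have "\<bar>c + D * word_value D w\<bar> \<le> \<bar>c\<bar> + D * \<bar>word_value D w\<bar>"
      using D_pos abs_triangle_ineq[of c "D * word_value D w"] by (simp add: abs_mult)
    ultimately have "\<bar>c + D * word_value D w\<bar> \<le> (\<bar>c\<bar> + 1) * D ^ Suc (length w)"
      by (simp add: algebra_simps)
    then show ?thesis unfolding fam_def K by blast
  qed
  have "tail_type c z = (\<lambda>X. {w \<in> wds. K w \<in> X}) {C \<in> fam. z \<in> C}" for z
    using K_fam by (auto simp: tail_type_def K_def)
  then have "range (tail_type c) \<subseteq> (\<lambda>X. {w \<in> wds. K w \<in> X}) ` Pow fam" by blast
  moreover have "finite fam" unfolding fam_def by (rule finite_kernel)
  ultimately show ?thesis by (meson finite_Pow_iff finite_imageI finite_subset)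
qed

text \<open>\<open>V\<close> and \<open>V'\<close> have equal length and carry \<open>r\<close> and
  \<open>s\<close> at the same position. Adding \<open>c - r\<close> there produces the digit
  \<open>c\<close> or \<open>c + (s - r)\<close>; everything below is absorbed, so membership
  reveals which block was hit.\<close>

lemma ladder:
  assumes ws: "\<alpha> \<in> wds" "\<alpha>' \<in> wds" "\<beta> \<in> wds" "\<beta>' \<in> wds"
    and len: "length \<alpha> = length \<alpha>'" "length \<beta> = length \<beta>'"
    and V: "V = \<alpha> @ r # \<beta>" "V' = \<alpha>' @ s # \<beta>'"
    and mem: "\<And>us. us \<in> lists {V, V'} \<Longrightarrow> c + D * prepend D \<beta> (prepend D (concat us) z) \<in> A"
    and nmem: "\<And>us. us \<in> lists {V, V'} \<Longrightarrow>
      c + (s - r) + D * prepend D \<beta>' (prepend D (concat us) z) \<notin> A"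
  shows False
proof -
  obtain N where N: "\<And>a b :: nat \<Rightarrow> int. \<not> (\<forall>i\<le>N. \<forall>j\<le>N. a i + b j \<in> A \<longleftrightarrow> i \<le> j)"
    using stable unfolding stable_set_def by blast
  \<comment> \<open>The \<open>j\<close> lowest blocks are \<open>V'\<close>, the rest
    \<open>V\<close>; \<open>a i\<close> acts at the distinguished digit of block \<open>i\<close>,
    so \<open>V'\<close> is hit exactly when \<open>i < j\<close>.\<close>
  define U where "U j = replicate j V' @ replicate (Suc N - j) V" for j
  define a where "a i = D ^ (i * length V + length \<alpha>) * (c - r)" for i
  define b where "b j = prepend D (concat (U j)) z" for j
  have lenV: "length V' = length V" using len V by simp
  have Vw: "V \<in> wds" "V' \<in> wds" using ws V by auto
  have U_lists: "U j \<in> lists {V, V'}" for j by (auto simp: U_def)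
  have *: "a i + b j \<in> A \<longleftrightarrow> j \<le> i" if "i \<le> N" "j \<le> N" for i j
  proof -
    have iU: "i < length (U j)" using that by (simp add: U_def)
    define W where "W = concat (take i (U j))"
    define t where "t = prepend D (concat (drop (Suc i) (U j))) z"
    have tk: "take i (U j) \<in> lists {V, V'}" "drop (Suc i) (U j) \<in> lists {V, V'}"
      using U_lists[of j] by (auto dest: in_set_takeD in_set_dropD)
    have len_concat: "length (concat us) = length us * length V" if "us \<in> lists {V, V'}" for us
      using that lenV by (induction us) auto
    have lenW: "length W = i * length V"
      unfolding W_def using len_concat[OF tk(1)] iU by simp
    have Ww: "W \<in> wds" unfolding W_def using tk(1) Vw by fastforce
    have "b j = prepend D (W @ U j ! i @ concat (drop (Suc i) (U j))) z"
      unfolding b_def W_def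
      by (subst id_take_nth_drop[OF iU]) simp
    then have bj: "b j = prepend D W (prepend D (U j ! i) t)"
      by (simp add: prepend_append t_def)
    have "a i + b j = prepend D W (prepend D (U j ! i) t + D ^ length \<alpha> * (c - r))"
      unfolding bj a_def prepend_add[symmetric] lenW
      by (simp add: power_add power_mult mult.assoc)
    then have mem1: "a i + b j \<in> A \<longleftrightarrow> prepend D (U j ! i) t + D ^ length \<alpha> * (c - r) \<in> A"
      using prepend_mem_iff[OF Ww] by simp
    show ?thesis
    proof (cases "j \<le> i")
      case True
      then have "U j ! i = V" using that by (simp add: U_def nth_append)
      then have "prepend D (U j ! i) t + D ^ length \<alpha> * (c - r)
          = prepend D \<alpha> (c + D * prepend D \<beta> t)"
        by (simp add: V prepend_append prepend_Cons prepend_add) (simp add: add.commute)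
      then show ?thesis
        using True mem1 mem[OF tk(2)] prepend_mem_iff[OF ws(1)] by (simp add: t_def)
    next
      case False
      then have "U j ! i = V'" using that by (simp add: U_def nth_append)
      then have "prepend D (U j ! i) t + D ^ length \<alpha> * (c - r)
          = prepend D \<alpha>' (c + (s - r) + D * prepend D \<beta>' t)"
        by (simp add: V len prepend_append prepend_Cons prepend_add) (simp add: algebra_simps)
      then show ?thesis
        using False mem1 nmem[OF tk(2)] prepend_mem_iff[OF ws(2)] by (simp add: t_def)
    qed
  qed
  \<comment> \<open>The order obtained is \<open>j \<le> i\<close>; reversing both indices gives the
    form in the definition of stability.\<close>
  have "a (N - i) + b (N - j) \<in> A \<longleftrightarrow> i \<le> j" if "i \<le> N" "j \<le> N" for i j
    using *[of "N - i" "N - j"] that by auto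
  then show False using N[of "\<lambda>i. a (N - i)" "\<lambda>j. b (N - j)"] by blast
qed

text \<open>By \<open>tail_type_prepend\<close> the type after a block depends only on the type
  before it, so type-preserving blocks can be chained.\<close>

lemma tail_type_concat:
  assumes "vs \<subseteq> wds" "us \<in> lists vs" "\<And>v. v \<in> vs \<Longrightarrow> tail_type c (prepend D v z) = tail_type c z"
  shows "tail_type c (prepend D (concat us) z) = tail_type c z"
  using assms(2)
proof (induction us)
  case (Cons v us)
  have "v \<in> wds" using Cons assms(1) by auto
  then have "tail_type c (prepend D (concat (v # us)) z) = tail_type c (prepend D v z)"
    using Cons.IH by (simp add: prepend_append tail_type_prepend)
  then show ?case using Cons assms(3) by auto
qed simp

text \<open>Choosing a tail with as few reachable types as possible makes its type reachable again.\<close>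

lemma recurrent_tail:
  obtains w where "w \<in> wds"
    "\<And>v. v \<in> wds \<Longrightarrow>
      \<exists>u\<in>wds. tail_type c (prepend D (u @ v @ w) x) = tail_type c (prepend D w x)"
proof -
  define R where "R w = (\<lambda>u. tail_type c (prepend D (u @ w) x)) ` wds" for w
  have finR: "finite (R w)" for w
    using finite_tail_types[of c] by (rule finite_subset[rotated]) (auto simp: R_def)
  obtain w where w: "w \<in> wds" "\<And>w'. w' \<in> wds \<Longrightarrow> card (R w) \<le> card (R w')"
    using ex_has_least_nat[of "\<lambda>w. w \<in> wds" "[]" "\<lambda>w. card (R w)"] by auto
  show ?thesis
  proof (rule that[OF w(1)])
    fix v assume v: "v \<in> wds"
    have "R (v @ w) \<subseteq> R w"
    proof
      fix y assume "y \<in> R (v @ w)"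
      then obtain u where "u \<in> wds" "y = tail_type c (prepend D ((u @ v) @ w) x)"
        by (auto simp: R_def)
      then show "y \<in> R w" unfolding R_def using v by (intro image_eqI[of _ _ "u @ v"]) auto
    qed
    then have "R (v @ w) = R w"
      using finR w v by (intro card_seteq) auto
    moreover have "tail_type c (prepend D w x) \<in> R w"
      unfolding R_def by (intro image_eqI[of _ _ "[]"]) auto
    ultimately have "tail_type c (prepend D w x) \<in> R (v @ w)" by simp
    then show "\<exists>u\<in>wds. tail_type c (prepend D (u @ v @ w) x) = tail_type c (prepend D w x)"
      unfolding R_def by (metis (no_types, lifting) imageE)
  qed
qed

text \<open>Over a recurrent tail, a failing word \<open>\<rho>\<close> would yield type-preserving
  blocks for \<open>ladder\<close>. Types are taken at the new offset, as only failure must survive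
  inserting blocks; success at \<open>c\<close> holds under all words by assumption.\<close>

lemma extend_progression:
  assumes mem: "\<And>w. w \<in> wds \<Longrightarrow> c + D * prepend D w x \<in> A"
  shows "\<exists>v\<in>wds. \<forall>w\<in>wds. c + (s - r) + D * prepend D w (prepend D v x) \<in> A"
proof -
  let ?c = "c + (s - r)"
  obtain v where v: "v \<in> wds"
    and rec: "\<And>w. w \<in> wds \<Longrightarrow>
      \<exists>u\<in>wds. tail_type ?c (prepend D (u @ w @ v) x) = tail_type ?c (prepend D v x)"
    using recurrent_tail by blast
  define z where "z = prepend D v x"
  have "?c + D * prepend D \<rho> z \<in> A" if \<rho>: "\<rho> \<in> wds" for \<rho>
  proof (rule ccontr)
    assume bad: "?c + D * prepend D \<rho> z \<notin> A"
    \<comment> \<open>Only the length of \<open>\<sigma>\<close> matters: it aligns the digit above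
      which it stands with the one below \<open>\<rho>\<close>, and \<open>mem\<close> covers every
      word.\<close>
    define \<sigma> where "\<sigma> = replicate (length \<rho>) r"
    have \<sigma>: "\<sigma> \<in> wds" by (auto simp: \<sigma>_def)
    obtain \<gamma> where \<gamma>: "\<gamma> \<in> wds" "tail_type ?c (prepend D (\<gamma> @ r # \<sigma>) z) = tail_type ?c z"
      using rec[of "r # \<sigma>"] \<sigma> by (auto simp: z_def simp flip: prepend_append)
    obtain \<gamma>' where \<gamma>': "\<gamma>' \<in> wds" "tail_type ?c (prepend D (\<gamma>' @ s # \<rho>) z) = tail_type ?c z"
      using rec[of "s # \<rho>"] \<rho> by (auto simp: z_def simp flip: prepend_append)
    define X X' where "X = \<gamma> @ r # \<sigma>" and "X' = \<gamma>' @ s # \<rho>"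
    have Xw: "X \<in> wds" "X' \<in> wds" using \<gamma> \<gamma>' \<sigma> \<rho> by (auto simp: X_def X'_def)
    \<comment> \<open>repeat the loops to equal length; the distinguished digits stay aligned as \<open>|\<sigma>| = |\<rho>|\<close>\<close>
    define pre pre' where "pre = concat (replicate (length X' - 1) X)"
      and "pre' = concat (replicate (length X - 1) X')"
    define \<alpha> \<alpha>' where "\<alpha> = pre @ \<gamma>" and "\<alpha>' = pre' @ \<gamma>'"
    define V V' where "V = \<alpha> @ r # \<sigma>" and "V' = \<alpha>' @ s # \<rho>"
    have pos: "length X > 0" "length X' > 0" by (auto simp: X_def X'_def)
    have Vcat: "V = concat (replicate (length X') X)" "V' = concat (replicate (length X) X')"
    proof -
      have "V = pre @ X" "V' = pre' @ X'"
        by (simp_all add: V_def V'_def \<alpha>_def \<alpha>'_def X_def X'_def)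
      moreover have "replicate n y = replicate (n - 1) y @ [y]" if "n > 0" for n and y :: "int list"
        using that by (cases n) (simp_all add: replicate_append_same)
      ultimately show "V = concat (replicate (length X') X)" "V' = concat (replicate (length X) X')"
        using pos by (simp_all add: pre_def pre'_def)
    qed
    have "length V = length X' * length X" "length V' = length X * length X'"
      unfolding Vcat by (simp_all add: length_concat sum_list_replicate)
    then have len: "length \<alpha> = length \<alpha>'"
      by (simp add: V_def V'_def \<sigma>_def mult.commute)
    have pre: "pre \<in> wds" "pre' \<in> wds" using Xw by (auto simp: pre_def pre'_def)
    \<comment> \<open>Each block returns the type of \<open>z\<close>, so \<open>\<rho>\<close>
      keeps failing below any sequence of blocks.\<close>
    have tt: "tail_type ?c (prepend D (concat us) z) = tail_type ?c z"
      if "us \<in> lists {V, V'}" for us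
    proof (rule tail_type_concat[OF _ that])
      show "{V, V'} \<subseteq> wds" using pre \<gamma>(1) \<gamma>'(1) \<sigma> \<rho> by (auto simp: V_def V'_def \<alpha>_def \<alpha>'_def)
      have "tail_type ?c (prepend D V z) = tail_type ?c z"
        unfolding Vcat using Xw(1) \<gamma>(2)
        by (intro tail_type_concat[of "{X}"]) (auto simp: X_def)
      moreover have "tail_type ?c (prepend D V' z) = tail_type ?c z"
        unfolding Vcat using Xw(2) \<gamma>'(2)
        by (intro tail_type_concat[of "{X'}"]) (auto simp: X'_def)
      ultimately show "tail_type ?c (prepend D w z) = tail_type ?c z" if "w \<in> {V, V'}" for w
        using that by auto
    qed
    have Vw: "V \<in> wds" "V' \<in> wds"
      using pre \<gamma>(1) \<gamma>'(1) \<sigma> \<rho> by (auto simp: V_def V'_def \<alpha>_def \<alpha>'_def)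
    show False
    proof (rule ladder[of \<alpha> \<alpha>' \<sigma> \<rho> V V' c z])
      show "\<alpha> \<in> wds" "\<alpha>' \<in> wds" "\<sigma> \<in> wds" "\<rho> \<in> wds"
        using pre \<gamma>(1) \<gamma>'(1) \<sigma> \<rho> by (auto simp: \<alpha>_def \<alpha>'_def)
      show "length \<alpha> = length \<alpha>'" "length \<sigma> = length \<rho>" using len by (auto simp: \<sigma>_def)
      show "V = \<alpha> @ r # \<sigma>" "V' = \<alpha>' @ s # \<rho>" by (auto simp: V_def V'_def)
    next
      fix us assume us: "us \<in> lists {V, V'}"
      then have "concat us \<in> wds" using Vw by fastforce
      then have "\<sigma> @ concat us @ v \<in> wds" using \<sigma> v by auto
      from mem[OF this] show "c + D * prepend D \<sigma> (prepend D (concat us) z) \<in> A"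
        by (simp add: z_def prepend_append)
      have "\<rho> \<notin> tail_type ?c z" using bad by (auto simp: tail_type_def)
      then have "\<rho> \<notin> tail_type ?c (prepend D (concat us) z)" using tt[OF us] by simp
      then show "?c + D * prepend D \<rho> (prepend D (concat us) z) \<notin> A"
        using \<rho> by (auto simp: tail_type_def)
    qed
  qed
  then show ?thesis using v z_def by blast
qed

text \<open>Quantifying over all \<open>w\<close> makes the induction work: a tail \<open>v\<close>
  chosen for the next term is absorbed into \<open>w @ v\<close> for the earlier ones. The first
  term comes from \<open>absorb_r\<close>.\<close>

lemma progressions:
  "\<exists>x. \<forall>w\<in>wds. \<forall>m\<le>M. r + int m * (s - r) + D * prepend D w x \<in> A"
proof (induction M)
  case 0
  obtain x where "x \<in> A" using nonempty by blast
  then show ?case using absorb_r prepend_mem_iff by auto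
next
  case (Suc M)
  then obtain x where x: "\<And>w m. w \<in> wds \<Longrightarrow> m \<le> M \<Longrightarrow>
      r + int m * (s - r) + D * prepend D w x \<in> A" by blast
  obtain v where v: "v \<in> wds"
    "\<forall>w\<in>wds. r + int M * (s - r) + (s - r) + D * prepend D w (prepend D v x) \<in> A"
    using extend_progression[of "r + int M * (s - r)" x] x by blast
  have "r + int m * (s - r) + D * prepend D w (prepend D v x) \<in> A"
    if w: "w \<in> wds" and "m \<le> Suc M" for w m
  proof (cases "m \<le> M")
    case True
    have "w @ v \<in> wds" using w v(1) by auto
    from x[OF this True] show ?thesis by (simp add: prepend_append)
  next
    case False
    then have "m = Suc M" using that by simp
    then show ?thesis using v(2) w by (simp add: algebra_simps)
  qed
  then show ?case by blast
qed

lemma generic: "generic_set A"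
proof (rule generic_set_if_long_progressions[OF stable])
  show "s - r \<noteq> 0" using r_neq_s by simp
  fix M
  obtain x where "\<forall>w\<in>wds. \<forall>m\<le>M. r + int m * (s - r) + D * prepend D w x \<in> A"
    using progressions by blast
  then have "\<forall>m\<le>M. (r + D * x) + int m * (s - r) \<in> A"
    by (auto dest!: bspec[of _ _ "[]"] simp: algebra_simps)
  then show "\<exists>x. \<forall>m\<le>M. x + int m * (s - r) \<in> A" by blast
qed

end

section \<open>Growth of regular languages\<close>

definition stays :: "('q \<Rightarrow> 'a \<Rightarrow> 'q) \<Rightarrow> 'q set \<Rightarrow> 'q \<Rightarrow> 'a list \<Rightarrow> bool" where
  "stays \<delta> P q w \<longleftrightarrow> (\<forall>k\<le>length w. foldl \<delta> q (take k w) \<in> P)"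

text \<open>Cut at the last visit to \<open>q\<close>: the part before is a loop, and after one more
  letter the run avoids \<open>q\<close>. The start counts as a visit, so a last one exists.\<close>

lemma last_visit_decomposition:
  assumes "stays \<delta> P q w"
  shows "foldl \<delta> q w = q \<or>
    (\<exists>l x v. w = l @ x # v \<and> foldl \<delta> q l = q \<and> stays \<delta> (P - {q}) (\<delta> q x) v)"
proof -
  define K where "K = {k. k \<le> length w \<and> foldl \<delta> q (take k w) = q}"
  have finK: "finite K" and K0: "0 \<in> K" by (auto simp: K_def)
  define k where "k = Max K"
  have kK: "k \<in> K" using Max_in[OF finK] K0 by (auto simp: k_def)
  have maxK: "j \<le> k" if "j \<in> K" for j using that finK by (simp add: k_def)
  show ?thesis
  proof (cases "k = length w")
    case True
    then show ?thesis using kK by (auto simp: K_def)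
  next
    case False
    then have k: "k < length w" "foldl \<delta> q (take k w) = q" using kK by (auto simp: K_def)
    have w: "w = take k w @ w ! k # drop (Suc k) w" using k(1) by (rule id_take_nth_drop)
    have "foldl \<delta> (\<delta> q (w ! k)) (take j (drop (Suc k) w)) \<in> P - {q}"
      if "j \<le> length (drop (Suc k) w)" for j
    proof -
      have j: "Suc (k + j) \<le> length w" using that k(1) by simp
      have "take (Suc (k + j)) w = take k w @ w ! k # take j (drop (Suc k) w)"
        using k(1) by (simp add: take_Suc_conv_app_nth take_add flip: add_Suc)
      then have eq: "foldl \<delta> q (take (Suc (k + j)) w)
          = foldl \<delta> (\<delta> q (w ! k)) (take j (drop (Suc k) w))"
        using k(2) by simp
      have "Suc (k + j) \<notin> K" using maxK[of "Suc (k + j)"] by auto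
      then show ?thesis using assms j eq by (auto simp: K_def stays_def)
    qed
    then have "stays \<delta> (P - {q}) (\<delta> q (w ! k)) (drop (Suc k) w)" by (simp add: stays_def)
    then show ?thesis using w k(2) by blast
  qed
qed

text \<open>Induction removes \<open>q\<close> from \<open>P\<close>. By the last-visit cut a word
  is a loop, or a loop, a letter and a run in \<open>P - {q}\<close>; there is at most one loop of
  each length, so each removed state costs a factor linear in \<open>n\<close>.\<close>

lemma card_staying_words_le:
  assumes "finite S" "finite P"
    and loops: "\<And>q v w. q \<in> P \<Longrightarrow> v \<in> lists S \<Longrightarrow> w \<in> lists S \<Longrightarrow> length v = length w \<Longrightarrow>
      foldl \<delta> q v = q \<Longrightarrow> foldl \<delta> q w = q \<Longrightarrow> v = w"
  shows "card {w \<in> lists S. length w = n \<and> stays \<delta> P q w} \<le> ((1 + card S) * (1 + n)) ^ card P"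
  using assms(2) loops
proof (induction "card P" arbitrary: P q n)
  case 0
  then have "P = {}" by simp
  then have none: "\<not> stays \<delta> P q w" for w by (auto simp: stays_def)
  show ?case by (simp add: none)
next
  case (Suc p)
  show ?case
  proof (cases "q \<in> P")
    case False
    then have none: "\<not> stays \<delta> P q w" for w by (auto simp: stays_def)
    show ?thesis by (simp add: none)
  next
    case True
    define B where "B = ((1 + card S) * (1 + n)) ^ p"
    define loop where "loop k = {l \<in> lists S. length l = k \<and> foldl \<delta> q l = q}" for k
    define rest where "rest x k = {w \<in> lists S. length w = n - Suc k \<and> stays \<delta> (P - {q}) (\<delta> q x) w}"
      for x k
    have fin_len: "finite {w \<in> lists S. length w = m \<and> R w}" for m R
      by (rule finite_subset[OF _ finite_lists_length_eq[OF assms(1), of m]]) (auto)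
    have fin: "finite (loop k)" "finite (rest x k)" for x k
      unfolding loop_def rest_def by (rule fin_len)+
    have loop1: "card (loop k) \<le> 1" for k
      using Suc.prems(2)[OF True] fin(1)[of k]
      by (subst One_nat_def, intro card_le_Suc0_iff_eq[THEN iffD2]) (auto simp: loop_def)
    have rest1: "card (rest x k) \<le> B" if "k < n" for x k
    proof -
      have cp: "card (P - {q}) = p" using Suc.hyps(2) True Suc.prems(1) by simp
      have "card (rest x k) \<le> ((1 + card S) * (1 + (n - Suc k))) ^ card (P - {q})"
        unfolding rest_def
        by (rule Suc.hyps(1)) (use cp Suc.prems in auto)
      also have "\<dots> \<le> B" unfolding cp B_def
        by (intro power_mono mult_left_mono) auto
      finally show ?thesis .
    qed
    have sub: "{w \<in> lists S. length w = n \<and> stays \<delta> P q w} \<subseteq>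
        loop n \<union> (\<Union>k<n. \<Union>x\<in>S. (\<lambda>(l, v). l @ x # v) ` (loop k \<times> rest x k))"
    proof
      fix w assume w: "w \<in> {w \<in> lists S. length w = n \<and> stays \<delta> P q w}"
      then consider "foldl \<delta> q w = q" |
        l x v where "w = l @ x # v" "foldl \<delta> q l = q" "stays \<delta> (P - {q}) (\<delta> q x) v"
        using last_visit_decomposition by fast
      then show "w \<in> loop n \<union> (\<Union>k<n. \<Union>x\<in>S. (\<lambda>(l, v). l @ x # v) ` (loop k \<times> rest x k))"
      proof cases
        case 1
        then show ?thesis using w by (simp add: loop_def)
      next
        case (2 l x v)
        then have "length l < n" "x \<in> S" "(l, v) \<in> loop (length l) \<times> rest x (length l)"
          using w by (auto simp: loop_def rest_def)
        then show ?thesis using 2(1) by (intro UnI2) (auto intro!: bexI image_eqI[of _ _ "(l, v)"])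
      qed
    qed
    have "card {w \<in> lists S. length w = n \<and> stays \<delta> P q w} \<le>
        card (loop n \<union> (\<Union>k<n. \<Union>x\<in>S. (\<lambda>(l, v). l @ x # v) ` (loop k \<times> rest x k)))"
      using sub fin assms(1) by (intro card_mono) auto
    also have "\<dots> \<le> card (loop n) +
        (\<Sum>k<n. card (\<Union>x\<in>S. (\<lambda>(l, v). l @ x # v) ` (loop k \<times> rest x k)))"
      by (intro order.trans[OF card_Un_le] add_left_mono card_UN_le) auto
    also have "\<dots> \<le> 1 + (\<Sum>k<n. \<Sum>x\<in>S. B)"
    proof (intro add_mono sum_mono)
      show "card (loop n) \<le> 1" by (rule loop1)
      fix k assume k: "k \<in> {..<n}"
      have "card (\<Union>x\<in>S. (\<lambda>(l, v). l @ x # v) ` (loop k \<times> rest x k))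
          \<le> (\<Sum>x\<in>S. card ((\<lambda>(l, v). l @ x # v) ` (loop k \<times> rest x k)))"
        by (rule card_UN_le[OF assms(1)])
      also have "\<dots> \<le> (\<Sum>x\<in>S. B)"
      proof (intro sum_mono)
        fix x
        have "card ((\<lambda>(l, v). l @ x # v) ` (loop k \<times> rest x k)) \<le> card (loop k \<times> rest x k)"
          using fin by (intro card_image_le) auto
        also have "\<dots> = card (loop k) * card (rest x k)" by (rule card_cartesian_product)
        also have "\<dots> \<le> 1 * B" using loop1 rest1 k by (intro mult_mono) auto
        finally show "card ((\<lambda>(l, v). l @ x # v) ` (loop k \<times> rest x k)) \<le> B" by simp
      qed
      finally show "card (\<Union>x\<in>S. (\<lambda>(l, v). l @ x # v) ` (loop k \<times> rest x k)) \<le> (\<Sum>x\<in>S. B)" .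
    qed
    \<comment> \<open>\<open>B \<ge> 1\<close> absorbs the single full-length loop into the
      product.\<close>
    also have "\<dots> \<le> (1 + card S) * (1 + n) * B"
    proof -
      have "B \<ge> 1" by (simp add: B_def)
      then show ?thesis by (simp add: algebra_simps)
    qed
    also have "\<dots> = ((1 + card S) * (1 + n)) ^ card P"
      by (simp add: B_def flip: Suc.hyps(2))
    finally show ?thesis .
  qed
qed

lemma stays_reachable_coaccessible:
  assumes "w \<in> lists S" "foldl \<delta> q w \<in> F"
  shows "stays \<delta> {foldl \<delta> q u | u. u \<in> lists S \<and> (\<exists>v\<in>lists S. foldl \<delta> q (u @ v) \<in> F)} q w"
  unfolding stays_def
proof (intro allI impI)
  fix k
  have "take k w \<in> lists S" "drop k w \<in> lists S"
    using assms(1) by (auto dest: in_set_takeD in_set_dropD)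
  moreover have "foldl \<delta> q (take k w @ drop k w) \<in> F" using assms(2) by simp
  ultimately show "foldl \<delta> q (take k w) \<in>
      {foldl \<delta> q u | u. u \<in> lists S \<and> (\<exists>v\<in>lists S. foldl \<delta> q (u @ v) \<in> F)}"
    by blast
qed

text \<open>Only reachable states from which \<open>F\<close> can be reached occur in accepting
  runs. Reachability supplies \<open>u\<close>, access to \<open>F\<close> supplies
  \<open>w\<close>; if no such state has two loops of equal length, the previous count
  applies.\<close>

lemma two_loops_or_polynomial_growth:
  assumes "finite S" "finite Q" "q0 \<in> Q" "\<forall>q\<in>Q. \<forall>x\<in>S. \<delta> q x \<in> Q"
  obtains (loops) u v v' w where "u \<in> lists S" "v \<in> lists S" "v' \<in> lists S" "w \<in> lists S"
      "length v = length v'" "v \<noteq> v'" "foldl \<delta> q0 (u @ v) = foldl \<delta> q0 u"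
      "foldl \<delta> q0 (u @ v') = foldl \<delta> q0 u" "foldl \<delta> q0 (u @ w) \<in> F"
  | (growth) C p where
      "\<And>k. card {w \<in> lists S. foldl \<delta> q0 w \<in> F \<and> length w \<le> k} \<le> C * (1 + k) ^ p"
proof -
  define P where "P = {foldl \<delta> q0 u | u. u \<in> lists S \<and> (\<exists>v\<in>lists S. foldl \<delta> q0 (u @ v) \<in> F)}"
  have closed: "foldl \<delta> q u \<in> Q" if "u \<in> lists S" "q \<in> Q" for u q
    using that assms(4) by (induction u arbitrary: q) auto
  have "P \<subseteq> Q" using closed assms(3) by (auto simp: P_def)
  then have finP: "finite P" using assms(2) finite_subset by blast
  show ?thesis
  proof (cases "\<exists>q\<in>P. \<exists>v\<in>lists S. \<exists>w\<in>lists S. length v = length w \<and>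
      foldl \<delta> q v = q \<and> foldl \<delta> q w = q \<and> v \<noteq> w")
    case True
    then obtain u x v w where "u \<in> lists S" "x \<in> lists S" "foldl \<delta> q0 (u @ x) \<in> F"
      "v \<in> lists S" "w \<in> lists S" "length v = length w" "v \<noteq> w"
      "foldl \<delta> (foldl \<delta> q0 u) v = foldl \<delta> q0 u" "foldl \<delta> (foldl \<delta> q0 u) w = foldl \<delta> q0 u"
      unfolding P_def by blast
    then show ?thesis using loops[of u v w x] by simp
  next
    case False
    define c where "c = card P"
    have "card {w \<in> lists S. foldl \<delta> q0 w \<in> F \<and> length w \<le> k} \<le> (1 + card S) ^ c * (1 + k) ^ Suc c"
      for k
    proof -
      have fin_len: "finite {w \<in> lists S. length w = m \<and> R w}" for m R
        by (rule finite_subset[OF _ finite_lists_length_eq[OF assms(1), of m]]) auto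
      have "{w \<in> lists S. foldl \<delta> q0 w \<in> F \<and> length w \<le> k}
          \<subseteq> (\<Union>n\<le>k. {w \<in> lists S. length w = n \<and> stays \<delta> P q0 w})"
        using stays_reachable_coaccessible[of _ S \<delta> q0 F] by (auto simp: P_def)
      then have "card {w \<in> lists S. foldl \<delta> q0 w \<in> F \<and> length w \<le> k}
          \<le> card (\<Union>n\<le>k. {w \<in> lists S. length w = n \<and> stays \<delta> P q0 w})"
        using fin_len by (intro card_mono) auto
      also have "\<dots> \<le> (\<Sum>n\<le>k. card {w \<in> lists S. length w = n \<and> stays \<delta> P q0 w})"
        by (rule card_UN_le) simp
      also have "\<dots> \<le> (\<Sum>n\<le>k. ((1 + card S) * (1 + k)) ^ c)"
      proof (rule sum_mono)
        fix n assume "n \<in> {..k}"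
        have "card {w \<in> lists S. length w = n \<and> stays \<delta> P q0 w} \<le> ((1 + card S) * (1 + n)) ^ c"
          unfolding c_def using False by (intro card_staying_words_le[OF assms(1) finP]) blast
        also have "\<dots> \<le> ((1 + card S) * (1 + k)) ^ c"
          using \<open>n \<in> {..k}\<close> by (intro power_mono mult_left_mono) auto
        finally show "card {w \<in> lists S. length w = n \<and> stays \<delta> P q0 w}
            \<le> ((1 + card S) * (1 + k)) ^ c" .
      qed
      \<comment> \<open>The extra factor \<open>1 + k\<close> counts the lengths from
        \<open>0\<close> to \<open>k\<close>.\<close>
      also have "\<dots> = (1 + card S) ^ c * (1 + k) ^ Suc c"
        by (simp only: power_mult_distrib sum_constant card_atMost power_Suc of_nat_id plus_1_eq_Suc mult_ac)
      finally show ?thesis .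
    qed
    then show ?thesis by (rule growth)
  qed
qed

section \<open>Canonical representations and residuals\<close>

text \<open>An injection of the finite state set into the naturals carries the automaton over, so
  product automata may be used directly.\<close>

lemma regular_langI:
  fixes Q :: "'q set"
  assumes "finite S" "finite Q" "q0 \<in> Q" "\<And>q x. q \<in> Q \<Longrightarrow> x \<in> S \<Longrightarrow> \<delta> q x \<in> Q"
    and L: "L = {w \<in> lists S. foldl \<delta> q0 w \<in> F}"
  shows "regular_lang S L"
proof -
  obtain f :: "'q \<Rightarrow> nat" where f: "inj_on f Q"
    using finite_imp_inj_to_nat_seg[OF assms(2)] by blast
  define g where "g = the_inv_into Q f"
  have gf: "g (f q) = q" if "q \<in> Q" for q
    using that f by (simp add: g_def the_inv_into_f_f)
  define \<delta>' where "\<delta>' n x = f (\<delta> (g n) x)" for n x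
  have run: "foldl \<delta>' (f q) w = f (foldl \<delta> q w) \<and> foldl \<delta> q w \<in> Q" if "q \<in> Q" "w \<in> lists S" for q w
    using that(2,1) by (induction w arbitrary: q) (auto simp: \<delta>'_def gf assms(4))
  have "foldl \<delta> q0 w \<in> F \<longleftrightarrow> foldl \<delta>' (f q0) w \<in> f ` (F \<inter> Q)" if "w \<in> lists S" for w
    using run[OF assms(3) that] f by (auto dest: inj_onD)
  then have "L = {w \<in> lists S. foldl \<delta>' (f q0) w \<in> f ` (F \<inter> Q)}" using L by blast
  moreover have "\<forall>q\<in>f ` Q. \<forall>x\<in>S. \<delta>' q x \<in> f ` Q" by (auto simp: \<delta>'_def gf assms(4))
  ultimately show ?thesis
    unfolding regular_lang_def using assms(1-3)
    by (intro conjI exI[of _ "f ` Q"] exI[of _ "f q0"] exI[of _ \<delta>'] exI[of _ "f ` (F \<inter> Q)"]) auto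
qed

lemma base_digits_word_value:
  assumes "d \<ge> 2" "w \<in> lists {0..d - 1}" "w \<noteq> [] \<longrightarrow> last w \<noteq> 0"
  shows "base_digits d (word_value d w) = w"
  using assms(2,3)
proof (induction w)
  case Nil
  then show ?case by (simp add: base_digits.simps)
next
  case (Cons k w)
  then have IH: "base_digits d (word_value d w) = w" and k: "0 \<le> k" "k < d"
    by (auto split: if_splits)
  have nonneg: "word_value d w \<ge> 0"
  proof -
    have "w \<in> lists {0..d - 1}" using Cons.hyps by blast
    then show ?thesis using assms(1) by (induction w) auto
  qed
  have "k + d * word_value d w > 0"
  proof (cases "w = []")
    case True
    then show ?thesis using Cons.prems k by auto
  next
    case False
    then have "word_value d w \<noteq> 0" using IH by (auto simp: base_digits.simps)
    then have "d * word_value d w > 0" using nonneg assms(1) by simp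
    then show ?thesis using k by linarith
  qed
  then show ?case
    using k assms(1) IH by (subst base_digits.simps) simp
qed

lemma last_base_digits:
  "base_digits d a \<noteq> [] \<Longrightarrow> last (base_digits d a) \<noteq> 0"
proof (induction d a rule: base_digits.induct)
  case (1 d a)
  have pos: "d \<ge> 2" "a > 0" using 1(2) by (auto simp: base_digits.simps[of d a] split: if_splits)
  have eq: "base_digits d a = (a mod d) # base_digits d (a div d)"
    using pos by (subst base_digits.simps) simp
  show ?case
  proof (cases "base_digits d (a div d) = []")
    case True
    then have "a div d \<le> 0" using pos by (auto simp: base_digits.simps[of d "a div d"] split: if_splits)
    then have "a div d = 0" using pos pos_imp_zdiv_nonneg_iff[of d a] by linarith
    then have "a mod d = a" using mod_mult_div_eq[of a d] by simp
    then show ?thesis using eq True pos by simp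
  next
    case False
    then show ?thesis using eq 1(1) pos by simp
  qed
qed

lemma range_canonical_rep:
  assumes "d \<ge> 2"
  shows "range (canonical_rep d) =
    {w \<in> lists {0..d - 1} \<union> lists {- d + 1..0}. w \<noteq> [] \<longrightarrow> last w \<noteq> 0}"
proof (intro equalityI subsetI)
  fix w assume "w \<in> range (canonical_rep d)"
  then obtain a where w: "w = canonical_rep d a" by blast
  show "w \<in> {w \<in> lists {0..d - 1} \<union> lists {- d + 1..0}. w \<noteq> [] \<longrightarrow> last w \<noteq> 0}"
    using base_digits_in_lists[OF assms, of a] base_digits_in_lists[OF assms, of "- a"]
      last_base_digits[of d a] last_base_digits[of d "- a"]
    by (auto simp: w canonical_rep_def in_lists_conv_set last_map)
next
  fix w assume w: "w \<in> {w \<in> lists {0..d - 1} \<union> lists {- d + 1..0}. w \<noteq> [] \<longrightarrow> last w \<noteq> 0}"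
  show "w \<in> range (canonical_rep d)"
  proof (cases "w \<in> lists {0..d - 1}")
    case True
    have "word_value d w \<ge> 0" using True assms by (induction w) auto
    then have "w = canonical_rep d (word_value d w)"
      using base_digits_word_value[OF assms True] w by (simp add: canonical_rep_def)
    then show ?thesis by blast
  next
    case False
    define u where "u = map uminus w"
    have wu: "w = map uminus u" by (simp add: u_def comp_def)
    have u: "u \<in> lists {0..d - 1}"
    proof -
      have "w \<in> lists {- d + 1..0}" using w False by blast
      then show ?thesis unfolding u_def by (induction w) auto
    qed
    have bd: "base_digits d (word_value d u) = u"
      using w by (intro base_digits_word_value[OF assms u]) (auto simp: u_def last_map)
    have "word_value d u \<ge> 0" using u assms by (induction u) auto
    \<comment> \<open>\<open>canonical_rep\<close> treats \<open>0\<close> in its nonnegative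
      branch; value \<open>0\<close> would make \<open>w\<close> empty, which belongs to the first
      case.\<close>
    moreover have "word_value d u \<noteq> 0"
      using bd False wu by (auto simp: base_digits.simps)
    ultimately have "w = canonical_rep d (- word_value d u)"
      using bd wu by (simp add: canonical_rep_def)
    then show ?thesis by blast
  qed
qed

lemma canonical_rep_image_eq:
  assumes "d \<ge> 2"
  shows "canonical_rep d ` A = {w \<in> range (canonical_rep d). word_value d w \<in> A}"
  using word_value_canonical_rep[OF assms] by auto

text \<open>Sparseness includes regularity, so a growth bound alone would not contradict the
  hypothesis. A product automaton adds the conditions of one sign and no leading zero.\<close>

lemma regular_canonical_reps:
  assumes d: "d \<ge> 2" and "automatic_set d A"
  shows "regular_lang (signed_digits d) (canonical_rep d ` A)"
proof -
  obtain Q :: "nat set" and q0 \<delta> F where dfa: "finite Q" "q0 \<in> Q" "F \<subseteq> Q"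
    "\<forall>q\<in>Q. \<forall>s\<in>signed_digits d. \<delta> q s \<in> Q"
    and L: "{w \<in> lists (signed_digits d). word_value d w \<in> A}
      = {w \<in> lists (signed_digits d). foldl \<delta> q0 w \<in> F}"
    using assms(2) unfolding automatic_set_def regular_lang_def by blast
  \<comment> \<open>record which signs have occurred and whether the last digit was \<open>0\<close>\<close>
  define \<eta> where "\<eta> = (\<lambda>(q, p, n, z :: bool) (x :: int). (\<delta> q x, p \<or> x > 0, n \<or> x < 0, x = 0))"
  have run: "foldl \<eta> (q, p, n, z) w = (foldl \<delta> q w, p \<or> (\<exists>x\<in>set w. x > 0), n \<or> (\<exists>x\<in>set w. x < 0),
      if w = [] then z else last w = 0)" for q p n z w
    by (induction w arbitrary: q p n z) (auto simp: \<eta>_def)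
  show ?thesis
  proof (rule regular_langI)
    show "finite (signed_digits d)" by (simp add: signed_digits_def)
    show "finite (Q \<times> (UNIV :: (bool \<times> bool \<times> bool) set))" using dfa by simp
    \<comment> \<open>The zero flag starts as \<open>False\<close> so that the empty word,
      representing \<open>0\<close>, is not rejected for a final zero.\<close>
    show "(q0, False, False, False) \<in> Q \<times> UNIV" using dfa by simp
    show "\<eta> q x \<in> Q \<times> UNIV" if "q \<in> Q \<times> UNIV" "x \<in> signed_digits d" for q x
      using that dfa by (auto simp: \<eta>_def)
    show "canonical_rep d ` A = {w \<in> lists (signed_digits d).
        foldl \<eta> (q0, False, False, False) w \<in> {(q, p, n, z). q \<in> F \<and> \<not> (p \<and> n) \<and> \<not> z}}"
    proof (intro set_eqI)
      fix w
      have canon: "w \<in> range (canonical_rep d) \<longleftrightarrow> w \<in> lists (signed_digits d) \<and>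
          \<not> ((\<exists>x\<in>set w. x > 0) \<and> (\<exists>x\<in>set w. x < 0)) \<and> \<not> (w \<noteq> [] \<and> last w = 0)"
        unfolding range_canonical_rep[OF d] signed_digits_def
        by (auto simp: in_lists_conv_set)
      have dfa_iff: "w \<in> {w \<in> lists (signed_digits d).
          foldl \<eta> (q0, False, False, False) w \<in> {(q, p, n, z). q \<in> F \<and> \<not> (p \<and> n) \<and> \<not> z}} \<longleftrightarrow>
          w \<in> lists (signed_digits d) \<and> foldl \<delta> q0 w \<in> F \<and>
          \<not> ((\<exists>x\<in>set w. x > 0) \<and> (\<exists>x\<in>set w. x < 0)) \<and> \<not> (w \<noteq> [] \<and> last w = 0)"
        by (simp add: run) blast
      have image_iff: "w \<in> canonical_rep d ` A \<longleftrightarrow> w \<in> range (canonical_rep d) \<and> word_value d w \<in> A"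
        using canonical_rep_image_eq[OF d, of A] by blast
      have mem_iff: "w \<in> lists (signed_digits d) \<Longrightarrow> word_value d w \<in> A \<longleftrightarrow> foldl \<delta> q0 w \<in> F"
        using L by blast
      show "w \<in> canonical_rep d ` A \<longleftrightarrow> w \<in> {w \<in> lists (signed_digits d).
        foldl \<eta> (q0, False, False, False) w \<in> {(q, p, n, z). q \<in> F \<and> \<not> (p \<and> n) \<and> \<not> z}}"
        unfolding dfa_iff image_iff canon using mem_iff by blast
    qed
  qed
qed

text \<open>Lowest digits agree modulo \<open>d\<close>, and with one sign they differ by less than
  \<open>d\<close>. Mixed signs would break this: \<open>1\<close> and
  \<open>(1 - d) + d * 1\<close> coincide.\<close>

lemma word_value_inj:
  assumes "length v = length w" "S = {0..d - 1} \<or> S = {- d + 1..0}" "v \<in> lists S" "w \<in> lists S"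
    "word_value d v = word_value d w"
  shows "v = w"
  using assms(1,3-5)
proof (induction v w rule: list_induct2)
  case (Cons x v y w)
  have "\<bar>x - y\<bar> < d" using Cons.prems assms(2) by auto
  moreover have "d dvd x - y"
    using Cons.prems(3) by (auto intro!: dvdI[of _ _ "word_value d w - word_value d v"] simp: algebra_simps)
  ultimately have "x = y" using dvd_imp_le_int[of "x - y" d] by force
  moreover have "d \<noteq> 0" using Cons.prems assms(2) by auto
  ultimately show ?case using Cons by auto
qed simp

lemma obtain_digits:
  assumes "0 \<le> c" "c < d ^ k" "d \<ge> 1"
  shows "\<exists>w\<in>lists {0..d - 1}. length w = k \<and> word_value d w = c"
  using assms(1,2)
proof (induction k arbitrary: c)
  case (Suc k)
  have "0 \<le> c div d" using Suc.prems assms(3) by (simp add: pos_imp_zdiv_nonneg_iff)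
  moreover have "c div d < d ^ k"
  proof (rule ccontr)
    assume "\<not> c div d < d ^ k"
    then have "d ^ k * d \<le> c div d * d" using assms(3) by (intro mult_right_mono) auto
    also have "\<dots> \<le> c" using div_mult_mod_eq[of c d] pos_mod_sign[of d c] assms(3) by linarith
    finally show False using Suc.prems by (simp add: mult.commute)
  qed
  ultimately obtain w where "w \<in> lists {0..d - 1}" "length w = k" "word_value d w = c div d"
    using Suc.IH by blast
  then show ?case using assms(3) by (intro bexI[of _ "(c mod d) # w"]) auto
qed simp

section \<open>Residuals of the automaton and the passage to two digit maps\<close>

locale digit_automaton =
  fixes d :: int and A :: "int set" and Q :: "nat set" and q0 \<delta> F
  assumes d: "d \<ge> 2"
    and finQ: "finite Q" and q0: "q0 \<in> Q"
    and \<delta>: "\<And>q x. q \<in> Q \<Longrightarrow> x \<in> signed_digits d \<Longrightarrow> \<delta> q x \<in> Q"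
    and acc: "\<And>w. w \<in> lists (signed_digits d) \<Longrightarrow> word_value d w \<in> A \<longleftrightarrow> foldl \<delta> q0 w \<in> F"
begin

text \<open>The left quotient at a state, as a set of numbers. At a reachable state any signed-digit
  word of value \<open>n\<close> gives the same answer as the canonical one, by
  \<open>acc\<close>.\<close>

definition residual :: "nat \<Rightarrow> int set" where
  "residual q = {n. foldl \<delta> q (canonical_rep d n) \<in> F}"

lemma prepend_mem_iff_residual:
  assumes "w \<in> lists (signed_digits d)"
  shows "prepend d w n \<in> A \<longleftrightarrow> n \<in> residual (foldl \<delta> q0 w)"
proof -
  have "word_value d (w @ canonical_rep d n) = prepend d w n"
    by (simp add: word_value_append prepend_def word_value_canonical_rep[OF d])
  then show ?thesis
    using acc[of "w @ canonical_rep d n"] assms canonical_rep_in_lists[OF d, of n]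
    by (simp add: residual_def)
qed

lemma run_in: "w \<in> lists (signed_digits d) \<Longrightarrow> q \<in> Q \<Longrightarrow> foldl \<delta> q w \<in> Q"
  by (induction w arbitrary: q) (auto simp: \<delta>)

text \<open>Division by \<open>d ^ k\<close> splits \<open>c\<close> into a digit word of length
  \<open>k\<close>, which leads to one of finitely many states, and a quotient in
  \<open>{- B..B}\<close>, which translates the residual there.\<close>

lemma finite_kernel: "finite {{n. c + d ^ k * n \<in> A} | k c. \<bar>c\<bar> \<le> B * d ^ k}"
proof (rule finite_subset)
  show "finite ((\<lambda>(q, m). {n. n + m \<in> residual q}) ` (Q \<times> {- B..B}))" using finQ by simp
  show "{{n. c + d ^ k * n \<in> A} | k c. \<bar>c\<bar> \<le> B * d ^ k}
      \<subseteq> (\<lambda>(q, m). {n. n + m \<in> residual q}) ` (Q \<times> {- B..B})"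
  proof clarify
    fix k c assume c: "\<bar>c\<bar> \<le> B * d ^ k"
    have dk: "d ^ k > 0" using d by simp
    obtain w where w: "w \<in> lists {0..d - 1}" "length w = k" "word_value d w = c mod d ^ k"
      using obtain_digits[of "c mod d ^ k" d k] d dk by auto
    have ws: "w \<in> lists (signed_digits d)" using w(1) d by (auto simp: signed_digits_def in_lists_conv_set)
    have "c + d ^ k * n = prepend d w (n + c div d ^ k)" for n
      using mod_mult_div_eq[of c "d ^ k"] by (simp add: prepend_def w algebra_simps)
    then have "{n. c + d ^ k * n \<in> A} = {n. n + c div d ^ k \<in> residual (foldl \<delta> q0 w)}"
      using prepend_mem_iff_residual[OF ws] by simp
    moreover have "c div d ^ k \<in> {- B..B}"
    proof -
      have "(- B) * d ^ k \<le> c" "c \<le> B * d ^ k" using c by auto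
      then have "((- B) * d ^ k) div d ^ k \<le> c div d ^ k" "c div d ^ k \<le> (B * d ^ k) div d ^ k"
        using dk by (intro zdiv_mono1; simp)+
      moreover have "((- B) * d ^ k) div d ^ k = - B" "(B * d ^ k) div d ^ k = B"
        using dk nonzero_mult_div_cancel_right[of "d ^ k"] by (metis less_irrefl)+
      ultimately show ?thesis by (simp only: atLeastAtMost_iff)
    qed
    ultimately show "{n. c + d ^ k * n \<in> A} \<in> (\<lambda>(q, m). {n. n + m \<in> residual q}) ` (Q \<times> {- B..B})"
      using run_in[OF ws q0] by (intro image_eqI[of _ _ "(foldl \<delta> q0 w, c div d ^ k)"]) auto
  qed
qed

text \<open>Prepending \<open>u\<close> turns these sets into kernel sets of \<open>A\<close>; the
  value of \<open>u\<close> raises the bound \<open>B\<close> by at most one.\<close>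

lemma finite_kernel_residual:
  assumes "u \<in> lists (signed_digits d)"
  shows "finite {{n. c + (d ^ l) ^ k * n \<in> residual (foldl \<delta> q0 u)} | k c. \<bar>c\<bar> \<le> B * (d ^ l) ^ k}"
proof (rule finite_subset)
  let ?e = "length u"
  show "finite {{n. c + d ^ k * n \<in> A} | k c. \<bar>c\<bar> \<le> (B + 1) * d ^ k}" by (rule finite_kernel)
  show "{{n. c + (d ^ l) ^ k * n \<in> residual (foldl \<delta> q0 u)} | k c. \<bar>c\<bar> \<le> B * (d ^ l) ^ k}
      \<subseteq> {{n. c + d ^ k * n \<in> A} | k c. \<bar>c\<bar> \<le> (B + 1) * d ^ k}"
  proof clarify
    fix k c assume c: "\<bar>c\<bar> \<le> B * (d ^ l) ^ k"
    let ?c = "prepend d u c" and ?k = "?e + l * k"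
    have "{n. c + (d ^ l) ^ k * n \<in> residual (foldl \<delta> q0 u)} = {n. ?c + d ^ ?k * n \<in> A}"
      using prepend_mem_iff_residual[OF assms, symmetric]
      by (simp add: power_add power_mult mult.assoc prepend_add)
    moreover have "\<bar>?c\<bar> \<le> (B + 1) * d ^ ?k"
    proof -
      have "\<bar>word_value d u\<bar> < d ^ ?e"
        using assms d by (intro abs_word_value_le) (auto simp: signed_digits_def in_lists_conv_set)
      also have "\<dots> \<le> d ^ ?k" using d by (intro power_increasing) auto
      finally have "\<bar>word_value d u\<bar> \<le> d ^ ?k" by simp
      moreover have "d ^ ?e * \<bar>c\<bar> \<le> d ^ ?e * (B * (d ^ l) ^ k)"
        using c d by (intro mult_left_mono) auto
      moreover have "\<bar>?c\<bar> \<le> \<bar>word_value d u\<bar> + d ^ ?e * \<bar>c\<bar>"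
        using d abs_triangle_ineq[of "word_value d u" "d ^ ?e * c"] by (simp add: prepend_def abs_mult)
      moreover have e: "d ^ ?k = d ^ ?e * (d ^ l) ^ k" by (simp add: power_add power_mult)
      ultimately show ?thesis unfolding e by (simp add: algebra_simps)
    qed
    ultimately show "\<exists>k' c'. {n. c + (d ^ l) ^ k * n \<in> residual (foldl \<delta> q0 u)} = {n. c' + d ^ k' * n \<in> A}
        \<and> \<bar>c'\<bar> \<le> (B + 1) * d ^ k'" by blast
  qed
qed

text \<open>The residual at the state after \<open>u\<close> is a \<open>branching_set\<close>:
  loops do not change the state, one sign keeps their values distinct, and \<open>w\<close> gives a
  member. Being an affine preimage of \<open>A\<close>, it inherits stability and passes genericity
  back.\<close>

lemma generic_if_two_loops:
  assumes "stable_set A" and S: "S = {0..d - 1} \<or> S = {- d + 1..0}"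
    and words: "u \<in> lists S" "v \<in> lists S" "v' \<in> lists S" "w \<in> lists S"
    and neq: "length v = length v'" "v \<noteq> v'"
    and loop: "foldl \<delta> q0 (u @ v) = foldl \<delta> q0 u" "foldl \<delta> q0 (u @ v') = foldl \<delta> q0 u"
    and final: "foldl \<delta> q0 (u @ w) \<in> F"
  shows "generic_set A"
proof -
  define E where "E = residual (foldl \<delta> q0 u)"
  have "S \<subseteq> signed_digits d" using S d by (auto simp: signed_digits_def)
  then have ws: "u \<in> lists (signed_digits d)" "v \<in> lists (signed_digits d)"
    "v' \<in> lists (signed_digits d)" "w \<in> lists (signed_digits d)"
    using words by blast+
  have E_eq: "E = {n. word_value d u + d ^ length u * n \<in> A}"
    using prepend_mem_iff_residual[OF ws(1)] by (auto simp: E_def prepend_def)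
  have absorb: "prepend d x n \<in> E \<longleftrightarrow> n \<in> E"
    if "x \<in> lists (signed_digits d)" "foldl \<delta> q0 (u @ x) = foldl \<delta> q0 u" for x n
    using prepend_mem_iff_residual[OF ws(1), of "prepend d x n"]
      prepend_mem_iff_residual[of "u @ x" n] that ws(1)
    by (simp add: E_def prepend_append)
  have less: "\<bar>word_value d x\<bar> < d ^ length x" if "x \<in> lists (signed_digits d)" for x
    using that d by (intro abs_word_value_le) (auto simp: signed_digits_def in_lists_conv_set)
  have "word_value d (u @ w) \<in> A" using acc[of "u @ w"] ws final by simp
  then have "word_value d w \<in> E" by (simp add: E_eq word_value_append)
  then interpret branching_set "d ^ length v" "word_value d v" "word_value d v'" E
  proof unfold_locales
    show "1 \<le> d ^ length v" using d by simp
    show "\<bar>word_value d v\<bar> < d ^ length v" "\<bar>word_value d v'\<bar> < d ^ length v"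
      using less[OF ws(2)] less[OF ws(3)] neq(1) by auto
    show "word_value d v \<noteq> word_value d v'" using word_value_inj[OF neq(1) S words(2,3)] neq(2) by blast
    show "word_value d v + d ^ length v * n \<in> E \<longleftrightarrow> n \<in> E" for n
      using absorb[OF ws(2) loop(1), of n] by (simp add: prepend_def)
    show "word_value d v' + d ^ length v * n \<in> E \<longleftrightarrow> n \<in> E" for n
      using absorb[OF ws(3) loop(2), of n] neq(1) by (simp add: prepend_def)
    show "finite {{n. c + (d ^ length v) ^ k * n \<in> E} | k c. \<bar>c\<bar> \<le> B * (d ^ length v) ^ k}" for B
      unfolding E_def by (rule finite_kernel_residual[OF ws(1)])
    show "stable_set E" unfolding E_eq by (rule stable_set_affine_preimage[OF assms(1)])
  qed auto
  show ?thesis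
    using generic d unfolding E_eq by (auto dest: generic_set_affine_preimage)
qed

end

section \<open>Combining the two signs\<close>

theorem theorem4p2:
  fixes d :: int and A :: "int set"
  assumes "d \<ge> 2"
    and "automatic_set d A"
    and "\<not> sparse_set d A"
    and "stable_set A"
  shows "generic_set A"
proof -
  obtain Q :: "nat set" and q0 \<delta> F where dfa: "finite Q" "q0 \<in> Q"
    "\<forall>q\<in>Q. \<forall>s\<in>signed_digits d. \<delta> q s \<in> Q"
    and L: "{w \<in> lists (signed_digits d). word_value d w \<in> A}
      = {w \<in> lists (signed_digits d). foldl \<delta> q0 w \<in> F}"
    using assms(2) unfolding automatic_set_def regular_lang_def by blast
  interpret digit_automaton d A Q q0 \<delta> F
    using assms(1) dfa L by unfold_locales auto
  define accepted where "accepted S k = {w \<in> lists S. foldl \<delta> q0 w \<in> F \<and> length w \<le> k}"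
    for S :: "int set" and k
  \<comment> \<open>Each sign is treated separately because distinct loops need distinct
    values.\<close>
  have dichotomy: "generic_set A \<or> (\<exists>C p. \<forall>k. card (accepted S k) \<le> C * (1 + k) ^ p)"
    if S: "S = {0..d - 1} \<or> S = {- d + 1..0}" for S
  proof -
    have S': "finite S" "S \<subseteq> signed_digits d" using S assms(1) by (auto simp: signed_digits_def)
    then have closed: "\<forall>q\<in>Q. \<forall>x\<in>S. \<delta> q x \<in> Q" using \<delta> by blast
    show ?thesis
    proof (cases rule: two_loops_or_polynomial_growth[where F = F, OF S'(1) dfa(1,2) closed])
      case 1
      then show ?thesis using generic_if_two_loops[OF assms(4) S] by blast
    next
      case 2
      then show ?thesis unfolding accepted_def by blast
    qed
  qed
  show ?thesis
  proof (rule ccontr)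
    assume "\<not> generic_set A"
    then obtain C p C' p' where bounds:
      "\<And>k. card (accepted {0..d - 1} k) \<le> C * (1 + k) ^ p"
      "\<And>k. card (accepted {- d + 1..0} k) \<le> C' * (1 + k) ^ p'"
      using dichotomy by metis
    \<comment> \<open>\<open>[:1, 1:]\<close> is the polynomial \<open>1 + X\<close>, so
      \<open>P\<close> is the sum of the bounds for the two signs.\<close>
    define P :: "real poly" where
      "P = smult (real C) ([:1, 1:] ^ p) + smult (real C') ([:1, 1:] ^ p')"
    have "real (card {w \<in> canonical_rep d ` A. length w \<le> k}) \<le> poly P (real k)" for k
    proof -
      have fin: "finite (accepted S k)" if "finite S" for S
        using finite_lists_length_le[OF that, of k]
        by (rule finite_subset[rotated]) (auto simp: accepted_def)
      \<comment> \<open>Canonical representations use digits of one sign only, so the two bounds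
        cover them all.\<close>
      have "{w \<in> canonical_rep d ` A. length w \<le> k}
          \<subseteq> accepted {0..d - 1} k \<union> accepted {- d + 1..0} k"
      proof
        fix w assume w: "w \<in> {w \<in> canonical_rep d ` A. length w \<le> k}"
        then have "w \<in> lists (signed_digits d)" "word_value d w \<in> A"
          using canonical_rep_in_lists[OF d] word_value_canonical_rep[OF d] by auto
        then have "foldl \<delta> q0 w \<in> F" using acc by blast
        moreover have "w \<in> lists {0..d - 1} \<union> lists {- d + 1..0}"
          using w range_canonical_rep[OF d] by blast
        ultimately show "w \<in> accepted {0..d - 1} k \<union> accepted {- d + 1..0} k"
          using w by (auto simp: accepted_def)
      qed
      then have "card {w \<in> canonical_rep d ` A. length w \<le> k}
          \<le> card (accepted {0..d - 1} k \<union> accepted {- d + 1..0} k)"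
        using fin by (intro card_mono) auto
      also have "\<dots> \<le> C * (1 + k) ^ p + C' * (1 + k) ^ p'"
        using card_Un_le bounds by (meson add_mono order.trans)
      finally have "real (card {w \<in> canonical_rep d ` A. length w \<le> k})
          \<le> real (C * (1 + k) ^ p + C' * (1 + k) ^ p')" by (rule of_nat_mono)
      then show ?thesis by (simp add: P_def poly_power)
    qed
    then have "sparse_set d A"
      unfolding sparse_set_def sparse_lang_def using regular_canonical_reps[OF d assms(2)] by blast
    then show False using assms(3) by blast
  qed
qed

end
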